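(* Let $p\ge 1$ and $M\ge 1$ be integers, let $a_1,\ldots,a_{p+1},b_1,\ldots,b_p$ be complex numbers, and put $$s_p=b_1+\cdots+b_p-a_1-a_2-\cdots-a_{p+1}.$$ Let $A_k^{(p)}$ ($k=0,1,2,\ldots$) be the coefficients, depending on the $a_i$ and $b_i$, defined in the context. Then, as $n\to\infty$ through positive integers, $$\frac{\Gamma(a_1+n)\Gamma(a_2+n)\cdots\Gamma(a_{p+1}+n)}{\Gamma(b_1+n)\cdots\Gamma(b_p+n)\,\Gamma(-s_p+n)}=1+\sum_{m=1}^{M}\frac{(a_1+s_p)_m\,(a_2+s_p)_m}{(1)_m\,(1+s_p-n)_m}\sum_{k=0}^{m}\frac{(-m)_k}{(a_1+s_p)_k\,(a_2+s_p)_k}\,A_k^{(p)}+O(n^{-M-1}).$$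
   Context: Pochhammer symbol: $(x)_0=1$ and $(x)_k=x(x+1)\cdots(x+k-1)$ for integers $k\ge 1$; thus $(x)_k=\Gamma(x+k)/\Gamma(x)$ whenever the right-hand side is defined, and $(1)_m=m!$. In the asymptotic formula the parameters $p$, $M$, $a_i$, $b_i$ are fixed; the constant implied by $O(n^{-M-1})$ may depend on them, and all expressions are considered for sufficiently large positive integers $n$. No non-integrality restriction is imposed on $s_p$. For $0\le k\le m$ the quotient $(a_i+s_p)_m/(a_i+s_p)_k$ ($i=1,2$) is understood as $(a_i+s_p+k)_{m-k}$. Coefficients $A_k^{(p)}$: they depend on $b_1,\ldots,b_p$ and $a_3,\ldots,a_{p+1}$ (not on $a_1,a_2$). For $p=1$: $A_0^{(1)}=1$ and $A_k^{(1)}=0$ for $k>0$. For $p=2$: $$A_k^{(2)}=\frac{(b_2-a_3)_k\,(b_1-a_3)_k}{k!}.$$ For $p=3$: $$A_k^{(3)}=\sum_{k_2=0}^{k}\frac{(b_3+b_2-a_4-a_3+k_2)_{k-k_2}\,(b_1-a_3)_{k-k_2}\,(b_3-a_4)_{k_2}\,(b_2-a_4)_{k_2}}{(k-k_2)!\,k_2!}.$$ For $p=4$: $$A_k^{(4)}=\sum_{k_2=0}^{k}\frac{(b_4+b_3+b_2-a_5-a_4-a_3+k_2)_{k-k_2}(b_1-a_3)_{k-k_2}}{(k-k_2)!}\sum_{k_3=0}^{k_2}\frac{(b_4+b_3-a_5-a_4+k_3)_{k_2-k_3}(b_2-a_4)_{k_2-k_3}}{(k_2-k_3)!}\cdot\frac{(b_4-a_5)_{k_3}(b_3-a_5)_{k_3}}{k_3!}.$$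 In general, writing $A_k^{(p)}=A_k^{(p)}(b_1,\ldots,b_p;\,a_3,\ldots,a_{p+1})$, for every $p\ge 2$ and $k\ge 0$ the coefficients are defined recursively, starting from the case $p=1$, by $$A_k^{(p)}(b_1,\ldots,b_p;\,a_3,\ldots,a_{p+1})=\sum_{l=0}^{k}\frac{\bigl(b_2+\cdots+b_p-a_3-\cdots-a_{p+1}+l\bigr)_{k-l}\,(b_1-a_3)_{k-l}}{(k-l)!}\;A_l^{(p-1)}(b_2,\ldots,b_p;\,a_4,\ldots,a_{p+1}),$$ where for $p=2$ the factor $A_l^{(1)}(b_2;\,)$ is $1$ if $l=0$ and $0$ if $l>0$. This recursion reproduces the displayed formulas for $p=2,3,4$. *)

theory Defs
  imports "HOL-Analysis.Analysis" "HOL-Library.Landau_Symbols"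
begin

text \<open>
  Parameters are functions on the naturals, indexed from 1: the coefficients for \<open>p\<close>
  use only \<open>b 1, \<dots>, b p\<close> and \<open>a 3, \<dots>, a (p + 1)\<close>. The recursive call drops the first
  parameter of either group, that is, it is applied to \<open>b 2, \<dots>, b p\<close> and
  \<open>a 4, \<dots>, a (p + 1)\<close>. The value at \<open>p = 0\<close> has no mathematical meaning.
\<close>
fun A_coeff :: "nat \<Rightarrow> (nat \<Rightarrow> complex) \<Rightarrow> (nat \<Rightarrow> complex) \<Rightarrow> nat \<Rightarrow> complex" where
  "A_coeff 0 a b k = 0"
| "A_coeff (Suc 0) a b k = (if k = 0 then 1 else 0)"
| "A_coeff (Suc (Suc q)) a b k =
     (\<Sum>l=0..k. pochhammer ((\<Sum>i=2..q + 2. b i) - (\<Sum>i=3..q + 3. a i) + of_nat l) (k - l)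
                 * pochhammer (b 1 - a 3) (k - l) / fact (k - l)
                 * A_coeff (Suc q) (\<lambda>i. a (i + 1)) (\<lambda>i. b (i + 1)) l)"

definition s_param :: "nat \<Rightarrow> (nat \<Rightarrow> complex) \<Rightarrow> (nat \<Rightarrow> complex) \<Rightarrow> complex" where
  "s_param p a b = (\<Sum>i=1..p. b i) - (\<Sum>i=1..p + 1. a i)"

text \<open>
  The \<open>m\<close>-th term of the expansion. The quotients \<open>(a\<^sub>i + s)\<^sub>m / (a\<^sub>i + s)\<^sub>k\<close> for
  \<open>i = 1, 2\<close> are written as \<open>(a\<^sub>i + s + k)\<^bsub>m - k\<^esub>\<close>, which is meaningful also when
  \<open>(a\<^sub>i + s)\<^sub>k = 0\<close>; this is why they occur inside the sum over \<open>k\<close>.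
\<close>
definition expansion_term ::
  "nat \<Rightarrow> (nat \<Rightarrow> complex) \<Rightarrow> (nat \<Rightarrow> complex) \<Rightarrow> nat \<Rightarrow> nat \<Rightarrow> complex" where
  "expansion_term p a b n m =
     1 / (pochhammer 1 m * pochhammer (1 + s_param p a b - of_nat n) m)
     * (\<Sum>k=0..m. pochhammer (- of_nat m) k
                   * pochhammer (a 1 + s_param p a b + of_nat k) (m - k)
                   * pochhammer (a 2 + s_param p a b + of_nat k) (m - k)
                   * A_coeff p a b k)"

lemma A_coeff_2:
  "A_coeff 2 a b k = pochhammer (b 2 - a 3) k * pochhammer (b 1 - a 3) k / fact k"
proof -
  have "A_coeff 2 a b k =
    (\<Sum>l=0..k. if l = 0 then pochhammer (b 2 - a 3) k * pochhammer (b 1 - a 3) k / fact k else 0)"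
    unfolding numeral_2_eq_2 A_coeff.simps
    by (intro sum.cong) (simp_all add: numeral_2_eq_2 numeral_3_eq_3)
  then show ?thesis by simp
qed

lemma A_coeff_3:
  "A_coeff 3 a b k =
     (\<Sum>k2=0..k. pochhammer (b 3 + b 2 - a 4 - a 3 + of_nat k2) (k - k2)
                  * pochhammer (b 1 - a 3) (k - k2)
                  * pochhammer (b 3 - a 4) k2 * pochhammer (b 2 - a 4) k2
                  / (fact (k - k2) * fact k2))"
proof -
  have e: "A_coeff (Suc (Suc 0)) = A_coeff 2" by (simp add: numeral_2_eq_2)
  have "{2..Suc 0 + 2} = {2, 3::nat}" and "{3..Suc 0 + 3} = {3, 4::nat}" by auto
  then have b: "(\<Sum>i=2..Suc 0 + 2. b i) = b 2 + b 3" and a: "(\<Sum>i=3..Suc 0 + 3. a i) = a 3 + a 4"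
    by simp_all
  have "A_coeff 3 a b k = A_coeff (Suc (Suc (Suc 0))) a b k" by (simp add: numeral_3_eq_3)
  also have "\<dots> = (\<Sum>k2=0..k. pochhammer (b 2 + b 3 - (a 3 + a 4) + of_nat k2) (k - k2)
                  * pochhammer (b 1 - a 3) (k - k2) / fact (k - k2)
                  * (pochhammer (b 3 - a 4) k2 * pochhammer (b 2 - a 4) k2 / fact k2))"
    unfolding A_coeff.simps e A_coeff_2 a b by (simp add: numeral_eq_Suc)
  finally show ?thesis by (simp add: algebra_simps)
qed

end

theory Submission
  imports Defs
begin

text \<open>
  Multiplying and dividing by \<open>\<Gamma>(\<sigma> + n)\<close> with \<open>\<sigma> = b\<^sub>1 + \<dots> + b\<^sub>p - a\<^sub>3 - \<dots> - a\<^bsub>p+1\<^esub>\<close> splits the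
  quotient into the factor with \<open>a\<^sub>1, a\<^sub>2\<close> and the rest, and the coefficients \<open>A\<^sub>k\<close> are those of
  \<open>\<Prod>\<^bsub>i\<ge>3\<^esub> \<Gamma>(a\<^sub>i + n) / \<Prod>\<^sub>i \<Gamma>(b\<^sub>i + n) \<sim> \<Sum>\<^sub>k A\<^sub>k / \<Gamma>(\<sigma> + n + k)\<close>. This follows by induction on \<open>p\<close>:
  each \<open>\<Gamma>(a\<^sub>3 + n) / (\<Gamma>(b\<^sub>1 + n) \<Gamma>(\<sigma>' + n + l))\<close> is expanded by Gauss' theorem for
  \<open>\<^sub>2F\<^sub>1(A, B; C; 1)\<close> with \<open>C = \<sigma> + n + l\<close>. The remaining factor
  \<open>\<Gamma>(a\<^sub>1 + n) \<Gamma>(a\<^sub>2 + n) / (\<Gamma>(- s + n) \<Gamma>(\<sigma> + n + k))\<close> is expanded in the same way with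
  \<open>C = 1 + s + k - n\<close>, where the series no longer need converge but is still asymptotic.

  Both expansions come from one exact contiguous relation for the partial sums of the series in \<open>C\<close>:
  up to a small defect they satisfy the first-order recurrence in \<open>n\<close> of the Gamma quotient, so
  the ratio of the two has differences \<open>O(n\<^bsup>-M-2\<^esup>)\<close>, and it tends to 1.
\<close>

section \<open>Decay of reciprocal linear factors and Pochhammer symbols\<close>

lemma linear_eventually_nonzero:
  fixes e c :: complex
  assumes "e \<noteq> 0"
  shows "eventually (\<lambda>n. e * of_nat n + c \<noteq> 0) sequentially"
proof -
  obtain N :: nat where N: "norm (c / e) < of_nat N"
    using reals_Archimedean2 by blast
  have "e * of_nat n + c \<noteq> 0" if "n \<ge> N" for n
  proof
    assume "e * of_nat n + c = 0"
    then have "of_nat n = - (c / e)"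
      using assms by (simp add: field_simps add_eq_0_iff)
    then have "norm (c / e) = of_nat n"
      by (metis norm_minus_cancel norm_of_nat)
    then show False using N that by simp
  qed
  then show ?thesis unfolding eventually_sequentially by blast
qed

lemma inverse_linear_bigo:
  fixes e c :: complex
  assumes "e \<noteq> 0"
  shows "(\<lambda>n. 1 / (e * of_nat n + c)) \<in> O(\<lambda>n::nat. 1 / of_nat n)"
proof -
  have "(\<lambda>n::nat. c / of_nat n) \<longlonglongrightarrow> 0"
    by (rule tendsto_divide_0[OF tendsto_const tendsto_of_nat])
  then have "(\<lambda>n::nat. 1 / (e + c / of_nat n)) \<longlonglongrightarrow> 1 / (e + 0)"
    using assms by (intro tendsto_intros) auto
  then have "(\<lambda>n::nat. 1 / (e + c / of_nat n)) \<in> O(\<lambda>_. 1)"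
    by (intro bigoI_tendsto[where c = "1 / e"]) auto
  then have "(\<lambda>n::nat. 1 / (e + c / of_nat n) * (1 / of_nat n)) \<in> O(\<lambda>n. 1 * (1 / of_nat n))"
    by (intro landau_o.big.mult) auto
  moreover have "eventually (\<lambda>n::nat. 1 / (e + c / of_nat n) * (1 / of_nat n)
      = 1 / (e * of_nat n + c)) sequentially"
    using eventually_gt_at_top[of 0] by eventually_elim (simp add: field_simps)
  ultimately show ?thesis
    by (subst (asm) landau_o.big.in_cong) auto
qed

text \<open>The slope \<open>e\<close> covers both later uses: Pochhammer bases moving to the right
  (\<open>e = 1\<close>) and to the left (\<open>e = -1\<close>) as \<open>n\<close> grows.\<close>

lemma inverse_pochhammer_bigo:
  fixes e c :: complex
  assumes "e \<noteq> 0"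
  shows "(\<lambda>n. 1 / pochhammer (e * of_nat n + c) k) \<in> O(\<lambda>n::nat. 1 / of_nat n ^ k)"
proof (induction k)
  case (Suc k)
  have "(\<lambda>n. 1 / pochhammer (e * of_nat n + c) k * (1 / (e * of_nat n + (c + of_nat k))))
      \<in> O(\<lambda>n::nat. 1 / of_nat n ^ k * (1 / of_nat n))"
    by (intro landau_o.big.mult Suc.IH inverse_linear_bigo assms)
  then show ?case by (simp add: pochhammer_Suc algebra_simps)
qed simp

lemma pochhammer_eventually_nonzero:
  fixes e c :: complex
  assumes "e \<noteq> 0"
  shows "eventually (\<lambda>n. pochhammer (e * of_nat n + c) k \<noteq> 0) sequentially"
proof (induction k)
  case (Suc k)
  show ?case
    using Suc.IH linear_eventually_nonzero[OF assms, of "c + of_nat k"]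
    by eventually_elim (simp add: pochhammer_Suc add_ac)
qed simp

lemma inverse_power_bigo_mono:
  assumes "k \<le> m"
  shows "(\<lambda>n. 1 / of_nat n ^ m) \<in> O(\<lambda>n::nat. 1 / of_nat n ^ k :: complex)"
proof (rule bigoI[where c = 1])
  show "eventually (\<lambda>n. norm (1 / of_nat n ^ m :: complex)
          \<le> 1 * norm (1 / of_nat n ^ k :: complex)) sequentially"
    using eventually_gt_at_top[of 0]
  proof eventually_elim
    case (elim n)
    then show ?case using assms
      by (simp add: norm_divide norm_power frac_le power_increasing)
  qed
qed

lemma bigo_inverse_power_tendsto_0:
  fixes f :: "nat \<Rightarrow> complex"
  assumes "f \<in> O(\<lambda>n. 1 / of_nat n ^ k)" "k > 0"
  shows "f \<longlonglongrightarrow> 0"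
proof -
  have "(\<lambda>n. 1 / of_nat n ^ 1) \<in> o(\<lambda>n::nat. 1 :: complex)"
    by (rule smalloI_tendsto) (auto intro!: tendsto_divide_0[OF tendsto_const tendsto_of_nat])
  moreover have "f \<in> O(\<lambda>n. 1 / of_nat n ^ 1)"
    using assms by (intro landau_o.big_trans[OF assms(1) inverse_power_bigo_mono]) auto
  ultimately have "f \<in> o(\<lambda>n::nat. 1)"
    using landau_o.big_small_trans by blast
  then show ?thesis by (rule smalloD_tendsto[where g = "\<lambda>_. 1", simplified])
qed

section \<open>From bounds on differences to bounds on remainders\<close>

lemma inverse_power_diff_ge:
  fixes n k :: nat
  assumes "n > 0" "k > 0"
  shows "1 / real n ^ (k + 1) \<le> 2 ^ k * (1 / real n ^ k - 1 / real (Suc n) ^ k)"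
proof -
  obtain j where k: "k = Suc j" using assms by (cases k) auto
  let ?x = "real n" and ?y = "real (Suc n)"
  have xy: "0 < ?x" "?x \<le> ?y" "?y \<le> 2 * ?x" using assms by auto
  have "1 / ?x ^ (k + 1) = 2 ^ k / ((2 * ?x) ^ k * ?x)"
    using xy by (simp add: field_simps power_mult_distrib)
  \<comment> \<open>The constant \<open>2 ^ k\<close> comes from
    \<open>n + 1 \<le> 2 * n\<close>.\<close>
  also have "\<dots> \<le> 2 ^ k / (?y ^ k * ?x)"
    using xy by (intro divide_left_mono mult_right_mono power_mono mult_pos_pos) auto
  also have "\<dots> = 2 ^ k * (1 / ?y ^ j * (1 / ?x - 1 / ?y))"
    using xy by (simp add: k field_simps)
  also have "1 / ?y ^ j * (1 / ?x - 1 / ?y) \<le> 1 / ?x ^ j * (1 / ?x) - 1 / ?y ^ j * (1 / ?y)"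
  proof -
    have "1 / ?y ^ j \<le> 1 / ?x ^ j" using xy by (intro divide_left_mono power_mono) auto
    then have "1 / ?y ^ j * (1 / ?x) \<le> 1 / ?x ^ j * (1 / ?x)"
      using xy by (intro mult_right_mono) auto
    then show ?thesis by (simp add: algebra_simps)
  qed
  finally show ?thesis by (simp add: k mult.commute)
qed

text \<open>Summing the differences from \<open>n\<close> to infinity costs one power of
  \<open>n\<close>: they are dominated by the differences of a sequence \<open>?u\<close> of order
  \<open>n^(-k)\<close>, which telescope.\<close>

lemma bigo_from_differences:
  fixes D :: "nat \<Rightarrow> complex"
  assumes lim: "D \<longlonglongrightarrow> L" and "k > 0"
    and diff: "(\<lambda>n. D (Suc n) - D n) \<in> O(\<lambda>n. 1 / of_nat n ^ (k + 1))"
  shows "(\<lambda>n. D n - L) \<in> O(\<lambda>n. 1 / of_nat n ^ k)"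
proof -
  obtain K where K: "K > 0"
    and "eventually (\<lambda>n. norm (D (Suc n) - D n) \<le> K * norm (1 / of_nat n ^ (k + 1) :: complex)) sequentially"
    using landau_o.bigE[OF diff] by blast
  then obtain N where N: "norm (D (Suc n) - D n) \<le> K * (1 / real n ^ (k + 1))" if "n \<ge> N" for n
    unfolding eventually_sequentially by (auto simp: norm_divide norm_power norm_mult)
  let ?u = "\<lambda>n. K * 2 ^ k * (1 / real n ^ k)"
  have step: "norm (D (Suc n) - D n) \<le> ?u n - ?u (Suc n)" if "n \<ge> N" "n > 0" for n
  proof -
    have "K * (1 / real n ^ (k + 1)) \<le> K * (2 ^ k * (1 / real n ^ k - 1 / real (Suc n) ^ k))"
      using that K \<open>k > 0\<close> by (intro mult_left_mono inverse_power_diff_ge) auto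
    with N[OF that(1)] show ?thesis by (simp add: algebra_simps)
  qed
  have sums: "norm (D (n + j) - D n) \<le> ?u n - ?u (n + j)" if "n \<ge> N" "n > 0" for n j
  proof (induction j)
    case (Suc j)
    have "norm (D (n + Suc j) - D n)
        \<le> norm (D (Suc (n + j)) - D (n + j)) + norm (D (n + j) - D n)"
      by (metis add_Suc_right norm_triangle_ineq diff_add_cancel add_diff_eq)
    with step[of "n + j"] Suc.IH that show ?case by simp
  qed simp
  \<comment> \<open>Let \<open>j\<close> tend to infinity in \<open>sums\<close>, after dropping the
    nonnegative \<open>?u (n + j)\<close>.\<close>
  have bound: "norm (D n - L) \<le> ?u n" if "n \<ge> N" "n > 0" for n
  proof -
    have "(\<lambda>j. norm (D (n + j) - D n)) \<longlonglongrightarrow> norm (L - D n)"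
      using LIMSEQ_ignore_initial_segment[OF lim, of n]
      by (intro tendsto_intros) (simp add: add.commute)
    moreover have "norm (D (n + j) - D n) \<le> ?u n" for j
    proof -
      have "0 \<le> ?u (n + j)" using K by simp
      with sums[OF that, of j] show ?thesis by linarith
    qed
    ultimately have "norm (L - D n) \<le> ?u n" by (intro LIMSEQ_le_const2) auto
    then show ?thesis by (simp add: norm_minus_commute)
  qed
  show ?thesis
  proof (rule bigoI[where c = "K * 2 ^ k"])
    show "eventually (\<lambda>n. norm (D n - L) \<le> K * 2 ^ k * norm (1 / of_nat n ^ k :: complex)) sequentially"
      using eventually_ge_at_top[of N] eventually_gt_at_top[of 0]
      by eventually_elim (use bound in \<open>simp add: norm_divide norm_power\<close>)
  qed
qed

text \<open>Dividing the cross difference by \<open>F n * F (Suc n)\<close>, which tends to 1, gives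
  the difference of \<open>S / F\<close>. Hence \<open>S / F - 1\<close> is of order
  \<open>n^(-k)\<close>, and multiplying by \<open>- F n\<close> gives \<open>F - S\<close>.\<close>

lemma bigo_of_cross_difference:
  fixes F S :: "nat \<Rightarrow> complex"
  assumes F: "F \<longlonglongrightarrow> 1" and S: "S \<longlonglongrightarrow> 1" and "k > 0"
    and diff: "(\<lambda>n. F n * S (Suc n) - F (Suc n) * S n) \<in> O(\<lambda>n. 1 / of_nat n ^ (k + 1))"
  shows "(\<lambda>n. F n - S n) \<in> O(\<lambda>n. 1 / of_nat n ^ k)"
proof -
  have nz: "eventually (\<lambda>n. F n \<noteq> 0) sequentially"
    using F by (rule tendsto_imp_eventually_ne) simp
  then have nz': "eventually (\<lambda>n. F (Suc n) \<noteq> 0) sequentially"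
    by (subst eventually_sequentially_Suc)
  have F': "(\<lambda>n. F (Suc n)) \<longlonglongrightarrow> 1" using F by (simp add: filterlim_sequentially_Suc)
  have "(\<lambda>n. 1 / (F n * F (Suc n))) \<longlonglongrightarrow> 1 / (1 * 1)"
    using F F' by (intro tendsto_intros) auto
  then have "(\<lambda>n. 1 / (F n * F (Suc n))) \<in> O(\<lambda>_. 1)"
    by (intro bigoI_tendsto[where c = 1]) auto
  then have "(\<lambda>n. 1 / (F n * F (Suc n)) * (F n * S (Suc n) - F (Suc n) * S n))
      \<in> O(\<lambda>n. 1 * (1 / of_nat n ^ (k + 1)))"
    using diff by (rule landau_o.big.mult)
  moreover have "eventually (\<lambda>n. 1 / (F n * F (Suc n)) * (F n * S (Suc n) - F (Suc n) * S n)
      = S (Suc n) / F (Suc n) - S n / F n) sequentially"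
    using nz nz' by eventually_elim (simp add: field_simps)
  ultimately have "(\<lambda>n. S (Suc n) / F (Suc n) - S n / F n) \<in> O(\<lambda>n. 1 / of_nat n ^ (k + 1))"
    by (subst (asm) landau_o.big.in_cong) auto
  moreover have "(\<lambda>n. S n / F n) \<longlonglongrightarrow> 1"
    using tendsto_divide[OF S F] by simp
  ultimately have "(\<lambda>n. S n / F n - 1) \<in> O(\<lambda>n. 1 / of_nat n ^ k)"
    using \<open>k > 0\<close> by (intro bigo_from_differences) auto
  moreover have "(\<lambda>n. - F n) \<in> O(\<lambda>_. 1)"
    using tendsto_minus[OF F] by (intro bigoI_tendsto[where c = "- 1"]) auto
  ultimately have "(\<lambda>n. - F n * (S n / F n - 1)) \<in> O(\<lambda>n. 1 * (1 / of_nat n ^ k))"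
    by (intro landau_o.big.mult)
  moreover have "eventually (\<lambda>n. - F n * (S n / F n - 1) = F n - S n) sequentially"
    using nz by eventually_elim (simp add: field_simps)
  ultimately show ?thesis by (subst (asm) landau_o.big.in_cong) auto
qed

section \<open>Partial sums of Gauss' series 2F1(A, B; C; 1) and their contiguous relation\<close>

definition gauss_sum :: "nat \<Rightarrow> complex \<Rightarrow> complex \<Rightarrow> complex \<Rightarrow> complex" where
  "gauss_sum M A B C = (\<Sum>m\<le>M. pochhammer A m * pochhammer B m / fact m / pochhammer C m)"

text \<open>Without the last term this is the recurrence in \<open>C\<close> of Gauss' value
  \<Gamma>(C) \<Gamma>(C-A-B) / (\<Gamma>(C-A) \<Gamma>(C-B)); truncation adds a single boundary
  term. The identity is purely algebraic, so it holds whether or not the full series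
  converges.\<close>

lemma gauss_sum_contiguous:
  assumes "pochhammer C (Suc M) \<noteq> 0"
  shows "C * (C - A - B) * gauss_sum M A B C = (C - A) * (C - B) * gauss_sum M A B (C + 1)
    - C * (pochhammer A (Suc M) * pochhammer B (Suc M) / fact M / pochhammer C (Suc M))"
  using assms
proof (induction M)
  case 0
  then show ?case by (simp add: gauss_sum_def field_simps)
next
  case (Suc M)
  let ?P = "pochhammer A (Suc M) * pochhammer B (Suc M) / fact (Suc M)"
  let ?c = "pochhammer C (Suc M)" and ?m = "of_nat (Suc M) :: complex"
  have nz: "?c \<noteq> 0" "C + ?m \<noteq> 0" "C \<noteq> 0"
    using Suc.prems pochhammer_rec[of C "Suc M"] by (auto simp: pochhammer_Suc[of _ "Suc M"])
  have shift: "pochhammer (C + 1) (Suc M) = ?c * (C + ?m) / C"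
    using nz pochhammer_rec[of C "Suc M"] pochhammer_Suc[of C "Suc M"] by (simp add: field_simps)
  \<comment> \<open>The sum telescopes: the defect of the \<open>m\<close>-th term is \<open>C\<close> times the difference of
    \<open>m T\<^sub>m / (C)\<^sub>m\<close> and its successor, \<open>T\<^sub>m = (A)\<^sub>m (B)\<^sub>m / m!\<close>.\<close>
  have "C * (C - A - B) * (?P / ?c) - (C - A) * (C - B) * (?P / pochhammer (C + 1) (Suc M))
      = C * ?P * ((C - A - B) * (C + ?m) - (C - A) * (C - B)) / (?c * (C + ?m))"
    unfolding shift using nz by (simp add: divide_simps) (simp add: algebra_simps)
  \<comment> \<open>The terms in \<open>C^2\<close> cancel; the right-hand form separates the
    boundary term of this index from the next one.\<close>
  also have "(C - A - B) * (C + ?m) - (C - A) * (C - B) = ?m * (C + ?m) - (A + ?m) * (B + ?m)"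
    by (simp add: algebra_simps)
  also have "C * ?P * (?m * (C + ?m) - (A + ?m) * (B + ?m)) / (?c * (C + ?m))
      = C * (?m * ?P / ?c) - C * (?P * (A + ?m) * (B + ?m) / (?c * (C + ?m)))"
    using nz by (simp add: divide_simps) (simp add: algebra_simps)
  also have "?m * ?P = pochhammer A (Suc M) * pochhammer B (Suc M) / fact M"
    unfolding fact_Suc by (simp del: of_nat_Suc)
  also have "?P * (A + ?m) * (B + ?m) / (?c * (C + ?m))
      = pochhammer A (Suc (Suc M)) * pochhammer B (Suc (Suc M)) / fact (Suc M) / pochhammer C (Suc (Suc M))"
    by (simp add: pochhammer_Suc[of _ "Suc M"] algebra_simps)
  finally have step: "C * (C - A - B) * (?P / ?c) - (C - A) * (C - B) * (?P / pochhammer (C + 1) (Suc M)) =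
      C * (pochhammer A (Suc M) * pochhammer B (Suc M) / fact M / ?c) -
      C * (pochhammer A (Suc (Suc M)) * pochhammer B (Suc (Suc M)) / fact (Suc M) / pochhammer C (Suc (Suc M)))" .
  \<comment> \<open>The old boundary term \<open>w\<close> cancels between the induction hypothesis
    and \<open>step\<close>; only the new one, \<open>w'\<close>, survives.\<close>
  have add: "x * (s + t) = y * (s' + t') - w'" if "x * s = y * s' - w" "x * t - y * t' = w - w'"
    for x y s s' t t' w w' :: complex
    using that by algebra
  have gauss_sum_Suc: "gauss_sum (Suc M) A B D = gauss_sum M A B D + ?P / pochhammer D (Suc M)" for D
    by (simp add: gauss_sum_def)
  show ?case unfolding gauss_sum_Suc by (rule add[OF Suc.IH[OF nz(1)] step])
qed


lemma gauss_sum_tendsto_1: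
  fixes e c :: complex
  assumes "e \<noteq> 0"
  shows "(\<lambda>n. gauss_sum M A B (e * of_nat n + c)) \<longlonglongrightarrow> 1"
proof (induction M)
  case (Suc M)
  have "(\<lambda>n. 1 / pochhammer (e * of_nat n + c) (Suc M)) \<longlonglongrightarrow> 0"
    by (intro bigo_inverse_power_tendsto_0[OF inverse_pochhammer_bigo[OF assms]]) simp
  from tendsto_add[OF Suc.IH tendsto_mult_right_zero[OF this,
        of "pochhammer A (Suc M) * pochhammer B (Suc M) / fact (Suc M)"]]
  show ?case
    by (simp add: gauss_sum_def)
qed (simp add: gauss_sum_def)

section \<open>Limits and shifts of Gamma quotients\<close>

lemma eventually_not_nonpos_Int:
  fixes z :: complex
  shows "eventually (\<lambda>n. z + of_nat n \<notin> \<int>\<^sub>\<le>\<^sub>0) sequentially"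
proof -
  obtain N :: nat where N: "norm z < of_nat N"
    using reals_Archimedean2 by blast
  have "z + of_nat n \<notin> \<int>\<^sub>\<le>\<^sub>0" if "n \<ge> N" for n
  proof
    assume "z + of_nat n \<in> \<int>\<^sub>\<le>\<^sub>0"
    then obtain m where "z + of_nat n = - of_nat m"
      by (elim nonpos_Ints_cases')
    then have "z = - of_nat (n + m)"
      by (simp add: algebra_simps add_eq_0_iff2)
    then have "norm z = of_nat (n + m)"
      by (metis norm_minus_cancel norm_of_nat)
    then show False using N that by simp
  qed
  then show ?thesis unfolding eventually_sequentially by blast
qed

text \<open>By the product formula, \<Gamma>(z + n + 1) is \<Gamma>(z) n! n^z times a sequence
  tending to 1/\<Gamma>(z). With equal parameter sums the factors n! n^z cancel, and the constants
  multiply to 1.\<close>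

lemma balanced_Gamma_quotient_tendsto_1:
  fixes \<alpha> \<beta> \<gamma> \<delta> :: complex
  assumes "\<alpha> + \<beta> = \<gamma> + \<delta>"
  shows "(\<lambda>n. Gamma (\<alpha> + of_nat n) * Gamma (\<beta> + of_nat n)
    / (Gamma (\<gamma> + of_nat n) * Gamma (\<delta> + of_nat n))) \<longlonglongrightarrow> 1" (is "?F \<longlonglongrightarrow> 1")
proof -
  have "eventually (\<lambda>n. \<alpha> + of_nat n \<notin> \<int>\<^sub>\<le>\<^sub>0 \<and> \<beta> + of_nat n \<notin> \<int>\<^sub>\<le>\<^sub>0
      \<and> \<gamma> + of_nat n \<notin> \<int>\<^sub>\<le>\<^sub>0 \<and> \<delta> + of_nat n \<notin> \<int>\<^sub>\<le>\<^sub>0) sequentially"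
    by (intro eventually_conj eventually_not_nonpos_Int)
  \<comment> \<open>A fixed shift moves all four parameters off the poles, where
    \<open>Gamma\<close> would have the default value 0.\<close>
  then obtain N where N: "\<alpha> + of_nat N \<notin> \<int>\<^sub>\<le>\<^sub>0" "\<beta> + of_nat N \<notin> \<int>\<^sub>\<le>\<^sub>0"
      "\<gamma> + of_nat N \<notin> \<int>\<^sub>\<le>\<^sub>0" "\<delta> + of_nat N \<notin> \<int>\<^sub>\<le>\<^sub>0"
    unfolding eventually_sequentially by blast
  define \<alpha>' \<beta>' \<gamma>' \<delta>' where defs: "\<alpha>' = \<alpha> + of_nat N" "\<beta>' = \<beta> + of_nat N"
      "\<gamma>' = \<gamma> + of_nat N" "\<delta>' = \<delta> + of_nat N"
  note N = N[folded defs]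
  have nz: "Gamma \<alpha>' \<noteq> 0" "Gamma \<beta>' \<noteq> 0" "Gamma \<gamma>' \<noteq> 0" "Gamma \<delta>' \<noteq> 0"
    using N by (auto simp: Gamma_eq_zero_iff)
  let ?G = "\<lambda>n. (Gamma \<alpha>' * Gamma \<beta>' / (Gamma \<gamma>' * Gamma \<delta>'))
      * (rGamma_series \<alpha>' n * rGamma_series \<beta>' n / (rGamma_series \<gamma>' n * rGamma_series \<delta>' n))"
  have "?G \<longlonglongrightarrow> (Gamma \<alpha>' * Gamma \<beta>' / (Gamma \<gamma>' * Gamma \<delta>'))
      * (rGamma \<alpha>' * rGamma \<beta>' / (rGamma \<gamma>' * rGamma \<delta>'))"
    using nz by (intro tendsto_intros) (auto simp: rGamma_inverse_Gamma)
  also have "(Gamma \<alpha>' * Gamma \<beta>' / (Gamma \<gamma>' * Gamma \<delta>'))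
      * (rGamma \<alpha>' * rGamma \<beta>' / (rGamma \<gamma>' * rGamma \<delta>')) = 1"
    using nz by (simp add: rGamma_inverse_Gamma field_simps)
  \<comment> \<open>The shift is \<open>Suc N\<close> because \<open>rGamma_series z n\<close>
    contains \<open>pochhammer z (n + 1)\<close>, with \<open>n + 1\<close> factors.\<close>
  also have "?G = (\<lambda>n. ?F (n + Suc N))"
  proof
    fix n
    define L :: complex where "L = of_real (ln (real n))"
    have exps: "exp (\<alpha>' * L) * exp (\<beta>' * L) = exp (\<gamma>' * L) * exp (\<delta>' * L)"
    proof -
      have "\<alpha>' + \<beta>' = \<gamma>' + \<delta>'" using assms unfolding defs by algebra
      then show ?thesis by (simp flip: exp_add distrib_right)
    qed
    \<comment> \<open>The factor \<open>fact n * exp (...)\<close> restores the denominator of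
      \<open>rGamma_series\<close>, so the identity is exact even at \<open>n = 0\<close>, whatever
      the value of \<open>ln 0\<close>.\<close>
    have shift: "Gamma (z + of_nat (n + Suc N)) =
        Gamma (z + of_nat N) * rGamma_series (z + of_nat N) n * (fact n * exp ((z + of_nat N) * L))"
      if "z + of_nat N \<notin> \<int>\<^sub>\<le>\<^sub>0" for z
      using that pochhammer_Gamma[of "z + of_nat N" "Suc n"] Gamma_eq_zero_iff[of "z + of_nat N"]
      by (simp add: rGamma_series_def L_def field_simps add_ac)
    have cancel: "x1 * r1 * (E * e1) * (x2 * r2 * (E * e2)) / (x3 * r3 * (E * e3) * (x4 * r4 * (E * e4)))
        = x1 * x2 / (x3 * x4) * (r1 * r2 / (r3 * r4))"
      if "E \<noteq> 0" "e3 \<noteq> 0" "e4 \<noteq> 0" "e1 * e2 = e3 * e4"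
      for x1 x2 x3 x4 r1 r2 r3 r4 E e1 e2 e3 e4 :: complex
    proof -
      have eqs: "x1 * r1 * (E * e1) * (x2 * r2 * (E * e2)) = x1 * x2 * (r1 * r2) * (E * E * (e1 * e2))"
        "x3 * r3 * (E * e3) * (x4 * r4 * (E * e4)) = x3 * x4 * (r3 * r4) * (E * E * (e3 * e4))"
        by (simp_all only: mult_ac)
      have "E * E * (e3 * e4) \<noteq> 0" using that by simp
      then show ?thesis unfolding eqs that(4) times_divide_times_eq
        by (rule mult_divide_mult_cancel_right)
    qed
    show "?G n = ?F (n + Suc N)"
      unfolding shift[OF N(1)[unfolded defs]] shift[OF N(2)[unfolded defs]]
        shift[OF N(3)[unfolded defs]] shift[OF N(4)[unfolded defs]] unfolding defs[symmetric]
      by (rule cancel[symmetric]) (use exps in auto)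
  qed
  finally show ?thesis by (rule LIMSEQ_offset)
qed

lemma eventually_Gamma_shift:
  fixes z :: complex
  shows "eventually (\<lambda>n. Gamma (z + of_nat k + of_nat n)
    = Gamma (z + of_nat n) * pochhammer (of_nat n + z) k) sequentially"
  using eventually_not_nonpos_Int[of z]
proof eventually_elim
  case (elim n)
  then show ?case
    using pochhammer_Gamma[of "z + of_nat n" k] Gamma_eq_zero_iff[of "z + of_nat n"]
    by (simp add: add_ac)
qed

lemma eventually_Gamma_nonzero:
  fixes z :: complex
  shows "eventually (\<lambda>n. Gamma (z + of_nat n) \<noteq> 0) sequentially"
  using eventually_not_nonpos_Int[of z] by eventually_elim (simp add: Gamma_eq_zero_iff)

lemma eventually_Gamma_Suc:
  fixes z :: complex
  shows "eventually (\<lambda>n. Gamma (z + of_nat (Suc n)) = (z + of_nat n) * Gamma (z + of_nat n)) sequentially"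
  using eventually_not_nonpos_Int[of z]
proof eventually_elim
  case (elim n)
  then show ?case using Gamma_plus1[of "z + of_nat n"] by (simp add: add_ac)
qed

section \<open>The two asymptotic Gauss expansions\<close>

lemma gauss_remainder_bigo:
  fixes e c d x :: complex and F :: "nat \<Rightarrow> complex"
  assumes "e \<noteq> 0" and "F \<longlonglongrightarrow> 1"
  shows "(\<lambda>n. x * F n * (1 / (e * of_nat n + d) * (1 / pochhammer (e * of_nat n + c) k)))
    \<in> O(\<lambda>n::nat. 1 / of_nat n ^ (k + 1))"
proof -
  have "(\<lambda>n. x * F n) \<in> O(\<lambda>_. 1)"
    using tendsto_mult_left[OF assms(2), of x] by (intro bigoI_tendsto[where c = "x * 1"]) auto
  from landau_o.big.mult[OF this landau_o.big.mult[OF inverse_linear_bigo inverse_pochhammer_bigo]]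
  show ?thesis using assms by simp
qed

lemma eq_divide_of_mult_eq:
  fixes w x y z :: "'a::field"
  assumes "w * z * x = w * y" "w \<noteq> 0" "z \<noteq> 0"
  shows "x = y / z"
  using assms by (simp add: mult.assoc eq_divide_eq mult.commute)

text \<open>Made for the recurrence of a Gamma quotient: \<open>p\<close>, \<open>q\<close>,
  \<open>k1\<close>, \<open>k2\<close> are the linear factors split off by \<Gamma>(z+1) = z
  \<Gamma>(z).\<close>

lemma mult_quotient_of_products:
  fixes K R :: "'a::field"
  assumes "K = k1 * k2" "K \<noteq> 0" "R = p * q"
  shows "K * (p * g1 * (q * g2) / (k1 * g3 * (k2 * g4))) = R * (g1 * g2 / (g3 * g4))"
  using assms by simp

text \<open>With \<open>C = n + c\<close> the quotient is Gauss' value itself. The cross difference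
  reduces to the boundary term over \<open>C - A - B\<close>; the \<open>M + 1\<close> Pochhammer
  factors and this extra divisor give order \<open>n^(-M-2)\<close>.\<close>

lemma gauss_expansion_at_top:
  "(\<lambda>n. Gamma (c + of_nat n) * Gamma (c - A - B + of_nat n)
      / (Gamma (c - A + of_nat n) * Gamma (c - B + of_nat n))
      - gauss_sum M A B (of_nat n + c)) \<in> O(\<lambda>n. 1 / of_nat n ^ (M + 1))"
  (is "(\<lambda>n. ?F n - ?S n) \<in> _")
proof (rule bigo_of_cross_difference)
  show lim: "?F \<longlonglongrightarrow> 1" by (rule balanced_Gamma_quotient_tendsto_1) simp
  show "?S \<longlonglongrightarrow> 1" using gauss_sum_tendsto_1[of 1 M A B c] by simp
  let ?x = "pochhammer A (Suc M) * pochhammer B (Suc M) / fact M"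
  have F': "(\<lambda>n. ?F (Suc n)) \<longlonglongrightarrow> 1" using lim by (subst filterlim_sequentially_Suc)
  have "(\<lambda>n. ?x * ?F (Suc n) * (1 / (1 * of_nat n + (c - A - B)) * (1 / pochhammer (1 * of_nat n + c) (Suc M))))
      \<in> O(\<lambda>n. 1 / of_nat n ^ (Suc M + 1))"
    by (rule gauss_remainder_bigo[OF _ F']) simp
  moreover have "eventually (\<lambda>n. ?x * ?F (Suc n) * (1 / (1 * of_nat n + (c - A - B))
      * (1 / pochhammer (1 * of_nat n + c) (Suc M))) = ?F n * ?S (Suc n) - ?F (Suc n) * ?S n) sequentially"
    using eventually_Gamma_Suc[of c] eventually_Gamma_Suc[of "c - A - B"]
      eventually_Gamma_Suc[of "c - A"] eventually_Gamma_Suc[of "c - B"]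
      eventually_Gamma_nonzero[of "c - A"] eventually_Gamma_nonzero[of "c - B"]
      linear_eventually_nonzero[OF one_neq_zero, of c] linear_eventually_nonzero[OF one_neq_zero, of "c - A - B"]
      linear_eventually_nonzero[OF one_neq_zero, of "c - A"] linear_eventually_nonzero[OF one_neq_zero, of "c - B"]
      pochhammer_eventually_nonzero[OF one_neq_zero, of c "Suc M"]
  proof eventually_elim
    case (elim n)
    define C where "C = of_nat n + c"
    note nz = elim(7-11)
    have C: "C \<noteq> 0" "C - A - B \<noteq> 0" "C - A \<noteq> 0" "C - B \<noteq> 0" "pochhammer C (Suc M) \<noteq> 0"
      using nz by (auto simp: C_def algebra_simps)
    define r where "r = ?x / pochhammer C (Suc M)"
    have F: "(C - A) * (C - B) * ?F (Suc n) = C * (C - A - B) * ?F n"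
      unfolding elim(1-4)
    proof (rule mult_quotient_of_products)
      show "(C - A) * (C - B) \<noteq> 0" using C by simp
    qed (simp_all add: C_def algebra_simps)
    have S: "C * (C - A - B) * ?S n = (C - A) * (C - B) * ?S (Suc n) - C * r"
      using gauss_sum_contiguous[OF C(5), of A B] by (simp add: C_def r_def add_ac)
    \<comment> \<open>After this multiplication both recurrences apply; their main terms
      cancel.\<close>
    have "C * (C - A - B) * (?F n * ?S (Suc n) - ?F (Suc n) * ?S n)
        = (C * (C - A - B) * ?F n) * ?S (Suc n) - ?F (Suc n) * (C * (C - A - B) * ?S n)"
      by (simp only: algebra_simps)
    also have "\<dots> = C * (r * ?F (Suc n))"
      unfolding S F[symmetric] by (simp only: algebra_simps)
    finally have "?F n * ?S (Suc n) - ?F (Suc n) * ?S n = r * ?F (Suc n) / (C - A - B)"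
      using C(1,2) by (rule eq_divide_of_mult_eq)
    moreover have "1 * of_nat n + (c - A - B) = C - A - B" "1 * of_nat n + c = C"
      by (simp_all add: C_def algebra_simps)
    ultimately show ?case
      by (simp only: r_def) simp
  qed
  ultimately show "(\<lambda>n. ?F n * ?S (Suc n) - ?F (Suc n) * ?S n) \<in> O(\<lambda>n. 1 / of_nat n ^ (M + 1 + 1))"
    by (subst (asm) landau_o.big.in_cong) auto
qed simp

text \<open>The argument of the series now decreases with \<open>n\<close>, so the contiguous
  relation is run backwards. The quotient is a reflected form of Gauss' value: it satisfies the same
  recurrence and tends to 1, which is all the argument needs.\<close>

lemma gauss_expansion_at_bot:
  "(\<lambda>n. Gamma (d + A + of_nat n) * Gamma (d + B + of_nat n)
      / (Gamma (d + of_nat n) * Gamma (d + A + B + of_nat n))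
      - gauss_sum M A B (1 - d - of_nat n)) \<in> O(\<lambda>n. 1 / of_nat n ^ (M + 1))"
  (is "(\<lambda>n. ?F n - ?S n) \<in> _")
proof (rule bigo_of_cross_difference)
  show lim: "?F \<longlonglongrightarrow> 1" by (rule balanced_Gamma_quotient_tendsto_1) simp
  show "?S \<longlonglongrightarrow> 1" using gauss_sum_tendsto_1[of "-1" M A B "1 - d"] by simp
  have e: "(- 1 :: complex) \<noteq> 0" by simp
  let ?x = "- (pochhammer A (Suc M) * pochhammer B (Suc M) / fact M)"
  have "(\<lambda>n. ?x * ?F n * (1 / (-1 * of_nat n + (- d - A - B)) * (1 / pochhammer (-1 * of_nat n + (- d)) (Suc M))))
      \<in> O(\<lambda>n. 1 / of_nat n ^ (Suc M + 1))"
    by (rule gauss_remainder_bigo[OF _ lim]) simp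
  moreover have "eventually (\<lambda>n. ?x * ?F n * (1 / (-1 * of_nat n + (- d - A - B))
      * (1 / pochhammer (-1 * of_nat n + (- d)) (Suc M))) = ?F n * ?S (Suc n) - ?F (Suc n) * ?S n) sequentially"
    using eventually_Gamma_Suc[of d] eventually_Gamma_Suc[of "d + A + B"]
      eventually_Gamma_Suc[of "d + A"] eventually_Gamma_Suc[of "d + B"]
      eventually_Gamma_nonzero[of d] eventually_Gamma_nonzero[of "d + A + B"]
      linear_eventually_nonzero[OF e, of "-d"] linear_eventually_nonzero[OF e, of "- d - A - B"]
      pochhammer_eventually_nonzero[OF e, of "-d" "Suc M"]
  proof eventually_elim
    case (elim n)
    \<comment> \<open>\<open>C\<close> is the argument of \<open>?S (Suc n)\<close>, and
      \<open>C + 1\<close> that of \<open>?S n\<close>.\<close>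
    define C where "C = - d - of_nat n"
    note nz = elim(7-9)
    have C: "C \<noteq> 0" "C - A - B \<noteq> 0" "pochhammer C (Suc M) \<noteq> 0"
      using nz by (auto simp: C_def algebra_simps)
    define r where "r = ?x / pochhammer C (Suc M)"
    \<comment> \<open>The linear factors from \<open>Gamma\<close> are the negatives of these; the
      signs cancel in pairs.\<close>
    have F: "C * (C - A - B) * ?F (Suc n) = (C - A) * (C - B) * ?F n"
      unfolding elim(1-4)
    proof (rule mult_quotient_of_products)
      show "C * (C - A - B) \<noteq> 0" using C by simp
    qed (simp_all add: C_def algebra_simps)
    have S: "C * (C - A - B) * ?S (Suc n) = (C - A) * (C - B) * ?S n + C * r"
      using gauss_sum_contiguous[OF C(3), of A B] by (simp add: C_def r_def algebra_simps)
    have "C * (C - A - B) * (?F n * ?S (Suc n) - ?F (Suc n) * ?S n)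
        = ?F n * (C * (C - A - B) * ?S (Suc n)) - (C * (C - A - B) * ?F (Suc n)) * ?S n"
      by (simp only: algebra_simps)
    also have "\<dots> = C * (r * ?F n)"
      unfolding S F by (simp only: algebra_simps)
    finally have "?F n * ?S (Suc n) - ?F (Suc n) * ?S n = r * ?F n / (C - A - B)"
      using C(1,2) by (rule eq_divide_of_mult_eq)
    moreover have "-1 * of_nat n + (- d - A - B) = C - A - B" "-1 * of_nat n + - d = C"
      by (simp_all add: C_def algebra_simps)
    ultimately show ?case
      by (simp only: r_def) simp
  qed
  ultimately show "(\<lambda>n. ?F n * ?S (Suc n) - ?F (Suc n) * ?S n) \<in> O(\<lambda>n. 1 / of_nat n ^ (M + 1 + 1))"
    by (subst (asm) landau_o.big.in_cong) auto
qed simp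


section \<open>Multiplying inverse factorial expansions\<close>

lemma sum_triangle_reindex:
  fixes g :: "nat \<Rightarrow> nat \<Rightarrow> 'a::comm_monoid_add"
  shows "(\<Sum>l\<le>M. \<Sum>j\<le>M - l. g l j) = (\<Sum>k\<le>M. \<Sum>l\<le>k. g l (k - l))"
proof -
  have "(\<Sum>l\<le>M. \<Sum>j\<le>M - l. g l j) = (\<Sum>(l, j)\<in>{(l, j). l + j \<le> M}. g l j)"
    by (subst sum.Sigma) (auto intro!: sum.cong)
  also have "\<dots> = (\<Sum>k\<le>M. \<Sum>l\<le>k. g l (k - l))"
    by (rule sum.triangle_reindex_eq)
  finally show ?thesis .
qed

text \<open>Dividing \<open>P\<close> by the \<open>l\<close>-th Pochhammer symbol gives a quotient
  \<open>Q l\<close> with shifted parameters, up to a prefactor of order \<open>n^(-l)\<close>;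
  hence \<open>Q l\<close> is needed only to order \<open>M - l\<close>. Since
  \<open>(y)_l (y + l)_j = (y)_(l + j)\<close>, the terms regroup by
  \<open>k = l + j\<close>.\<close>

lemma inverse_factorial_expansion_mult:
  fixes e c \<sigma> :: complex and X P :: "nat \<Rightarrow> complex" and \<alpha> \<kappa> :: "nat \<Rightarrow> complex"
    and Q :: "nat \<Rightarrow> nat \<Rightarrow> complex" and \<gamma> :: "nat \<Rightarrow> nat \<Rightarrow> complex"
  assumes e: "e \<noteq> 0"
    and X: "(\<lambda>n. X n - (\<Sum>l\<le>M. \<alpha> l / pochhammer (of_nat n + \<sigma>) l)) \<in> O(\<lambda>n. 1 / of_nat n ^ (M + 1))"
    and P: "P \<longlonglongrightarrow> 1"
    and PQ: "\<And>l. l \<le> M \<Longrightarrow> eventually (\<lambda>n. P n / pochhammer (of_nat n + \<sigma>) l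
        = \<kappa> l / pochhammer (e * of_nat n + c) l * Q l n) sequentially"
    and Q: "\<And>l. l \<le> M \<Longrightarrow> (\<lambda>n. Q l n - (\<Sum>j\<le>M - l. \<gamma> l j / pochhammer (e * of_nat n + c + of_nat l) j))
        \<in> O(\<lambda>n. 1 / of_nat n ^ (M - l + 1))"
  shows "(\<lambda>n. P n * X n - (\<Sum>k\<le>M. (\<Sum>l\<le>k. \<alpha> l * \<kappa> l * \<gamma> l (k - l)) / pochhammer (e * of_nat n + c) k))
    \<in> O(\<lambda>n. 1 / of_nat n ^ (M + 1))"
proof -
  let ?p = "\<lambda>n k. pochhammer (e * of_nat n + c) k"
  let ?R = "\<lambda>l n. Q l n - (\<Sum>j\<le>M - l. \<gamma> l j / pochhammer (e * of_nat n + c + of_nat l) j)"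
  have "P \<in> O(\<lambda>_. 1)" using P by (intro bigoI_tendsto[where c = 1]) auto
  from landau_o.big.mult[OF this X]
  have 1: "(\<lambda>n. P n * (X n - (\<Sum>l\<le>M. \<alpha> l / pochhammer (of_nat n + \<sigma>) l)))
      \<in> O(\<lambda>n. 1 / of_nat n ^ (M + 1))" by simp
  have 2: "(\<lambda>n. \<Sum>l\<le>M. \<alpha> l * \<kappa> l * (1 / ?p n l * ?R l n)) \<in> O(\<lambda>n. 1 / of_nat n ^ (M + 1))"
  proof (rule big_sum_in_bigo)
    fix l assume "l \<in> {..M}"
    then have l: "l \<le> M" by simp
    have "(\<lambda>n. 1 / ?p n l * ?R l n) \<in> O(\<lambda>n. 1 / of_nat n ^ l * (1 / of_nat n ^ (M - l + 1)))"
      by (intro landau_o.big.mult inverse_pochhammer_bigo e Q l)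
    also have "(\<lambda>n. 1 / of_nat n ^ l * (1 / of_nat n ^ (M - l + 1))) = (\<lambda>n. 1 / of_nat n ^ (M + 1) :: complex)"
    proof -
      have "x ^ l * x ^ (M - l + 1) = x ^ (M + 1)" for x :: complex
        using l by (subst power_add[symmetric]) simp
      then show ?thesis by (simp only: times_divide_times_eq mult_1)
    qed
    finally have R: "(\<lambda>n. 1 / ?p n l * ?R l n) \<in> O(\<lambda>n. 1 / of_nat n ^ (M + 1))" .
    have "(\<lambda>_::nat. \<alpha> l * \<kappa> l) \<in> O(\<lambda>_. 1)" by simp
    from landau_o.big.mult[OF this R]
    show "(\<lambda>n. \<alpha> l * \<kappa> l * (1 / ?p n l * ?R l n)) \<in> O(\<lambda>n. 1 / of_nat n ^ (M + 1))"
      by (simp only: mult_1)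
  qed
  have "eventually (\<lambda>n. \<forall>l\<in>{..M}. P n / pochhammer (of_nat n + \<sigma>) l = \<kappa> l / ?p n l * Q l n) sequentially"
    using PQ by (intro eventually_ball_finite) auto
  \<comment> \<open>The error of \<open>X\<close> and the weighted errors of the \<open>Q l\<close>
    add up to the total error: the intermediate sums over \<open>l\<close> cancel by
    \<open>PQ\<close>.\<close>
  then have "eventually (\<lambda>n. P n * (X n - (\<Sum>l\<le>M. \<alpha> l / pochhammer (of_nat n + \<sigma>) l))
      + (\<Sum>l\<le>M. \<alpha> l * \<kappa> l * (1 / ?p n l * ?R l n))
      = P n * X n - (\<Sum>k\<le>M. (\<Sum>l\<le>k. \<alpha> l * \<kappa> l * \<gamma> l (k - l)) / ?p n k)) sequentially"
  proof eventually_elim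
    case (elim n)
    have "(\<Sum>k\<le>M. (\<Sum>l\<le>k. \<alpha> l * \<kappa> l * \<gamma> l (k - l)) / ?p n k)
        = (\<Sum>k\<le>M. \<Sum>l\<le>k. \<alpha> l * \<kappa> l * \<gamma> l (k - l) / ?p n (l + (k - l)))"
      by (simp add: sum_divide_distrib)
    also have "\<dots> = (\<Sum>l\<le>M. \<Sum>j\<le>M - l. \<alpha> l * \<kappa> l * \<gamma> l j / ?p n (l + j))"
      by (rule sum_triangle_reindex[symmetric])
    also have "\<dots> = (\<Sum>l\<le>M. \<alpha> l * \<kappa> l * (1 / ?p n l
        * (\<Sum>j\<le>M - l. \<gamma> l j / pochhammer (e * of_nat n + c + of_nat l) j)))"
      by (simp add: pochhammer_product' sum_distrib_left)
    finally have T: "(\<Sum>k\<le>M. (\<Sum>l\<le>k. \<alpha> l * \<kappa> l * \<gamma> l (k - l)) / ?p n k)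
      = (\<Sum>l\<le>M. \<alpha> l * \<kappa> l * (1 / ?p n l
        * (\<Sum>j\<le>M - l. \<gamma> l j / pochhammer (e * of_nat n + c + of_nat l) j)))" .
    have "P n * (\<Sum>l\<le>M. \<alpha> l / pochhammer (of_nat n + \<sigma>) l)
        = (\<Sum>l\<le>M. \<alpha> l * (P n / pochhammer (of_nat n + \<sigma>) l))"
      by (simp add: sum_distrib_left mult_ac)
    also have "\<dots> = (\<Sum>l\<le>M. \<alpha> l * \<kappa> l * (1 / ?p n l * Q l n))"
      using elim by (intro sum.cong) (simp_all add: mult_ac)
    finally show ?case
      unfolding T by (simp add: right_diff_distrib sum_subtractf)
  qed
  from landau_o.big.in_cong[OF this] sum_in_bigo(1)[OF 1 2] show ?thesis by blast
qed

section \<open>Induction on the number of parameters\<close>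

lemma Gamma_quotient_expansion:
  "(\<lambda>n. (\<Prod>i=3..q + 2. Gamma (a i + of_nat n)) / (\<Prod>i=1..Suc q. Gamma (b i + of_nat n))
      * Gamma ((\<Sum>i=1..Suc q. b i) - (\<Sum>i=3..q + 2. a i) + of_nat n)
    - (\<Sum>k\<le>M. A_coeff (Suc q) a b k
        / pochhammer (of_nat n + ((\<Sum>i=1..Suc q. b i) - (\<Sum>i=3..q + 2. a i))) k))
   \<in> O(\<lambda>n. 1 / of_nat n ^ (M + 1))"
proof (induction q arbitrary: a b)
  case 0
  \<comment> \<open>Here the numerator product is empty and the quotient is \<Gamma>(b 1 + n) /
    \<Gamma>(b 1 + n), so the error vanishes eventually.\<close>
  have "eventually (\<lambda>n. 0 = (\<Prod>i=3..0 + 2. Gamma (a i + of_nat n)) / (\<Prod>i=1..Suc 0. Gamma (b i + of_nat n))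
      * Gamma ((\<Sum>i=1..Suc 0. b i) - (\<Sum>i=3..0 + 2. a i) + of_nat n)
    - (\<Sum>k\<le>M. A_coeff (Suc 0) a b k
        / pochhammer (of_nat n + ((\<Sum>i=1..Suc 0. b i) - (\<Sum>i=3..0 + 2. a i))) k)) sequentially"
    using eventually_Gamma_nonzero[of "b 1"]
  proof eventually_elim
    case (elim n)
    have "(\<Sum>k\<le>M. A_coeff (Suc 0) a b k / pochhammer x k) = 1" for x
    proof -
      have "(\<Sum>k\<le>M. A_coeff (Suc 0) a b k / pochhammer x k) = (\<Sum>k\<le>M. if k = 0 then 1 else 0)"
        by (intro sum.cong) auto
      then show ?thesis by simp
    qed
    with elim show ?case by simp
  qed
  from landau_o.big.in_cong[OF this] show ?case by simp
next
  case (Suc q)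
  let ?a = "\<lambda>i. a (i + 1)" and ?b = "\<lambda>i. b (i + 1)"
  define \<sigma> where "\<sigma> = (\<Sum>i=1..Suc (Suc q). b i) - (\<Sum>i=3..Suc q + 2. a i)"
  define \<sigma>' where "\<sigma>' = (\<Sum>i=1..Suc q. ?b i) - (\<Sum>i=3..q + 2. ?a i)"
  define X where "X = (\<lambda>n. (\<Prod>i=3..q + 2. Gamma (?a i + of_nat n))
      / (\<Prod>i=1..Suc q. Gamma (?b i + of_nat n)) * Gamma (\<sigma>' + of_nat n))"
  \<comment> \<open>\<open>P\<close> restores the parameters \<open>a 3\<close> and
    \<open>b 1\<close> and replaces \<Gamma>(\<sigma>' + n) by \<Gamma>(\<sigma> + n);
    \<open>Q l\<close> raises both \<sigma> and \<sigma>' by \<open>l\<close>.\<close>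
  define P where "P = (\<lambda>n. Gamma (\<sigma> + of_nat n) * Gamma (a 3 + of_nat n)
      / (Gamma (b 1 + of_nat n) * Gamma (\<sigma>' + of_nat n)))"
  define Q where "Q = (\<lambda>l n. Gamma (\<sigma> + of_nat l + of_nat n) * Gamma (a 3 + of_nat n)
      / (Gamma (b 1 + of_nat n) * Gamma (\<sigma>' + of_nat l + of_nat n)))"
  define \<gamma> where "\<gamma> = (\<lambda>l j. pochhammer (\<sigma>' + of_nat l - a 3) j * pochhammer (b 1 - a 3) j / fact j)"
  have split_head: "{1..Suc (Suc q)} = insert 1 {2..Suc (Suc q)}" "{3..Suc q + 2} = insert 3 {4..q + 3}"
    by auto
  have shift_sets: "{2..Suc (Suc q)} = Suc ` {1..Suc q}" "{4..q + 3} = Suc ` {3..q + 2}"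
    by (simp_all add: image_Suc_atLeastAtMost)
  have head_notin: "1 \<notin> Suc ` {1..Suc q}" "3 \<notin> Suc ` {3..q + 2}" by auto
  have \<sigma>: "\<sigma> = \<sigma>' + b 1 - a 3"
    using head_notin unfolding \<sigma>_def \<sigma>'_def split_head shift_sets
    by (simp add: sum.reindex del: sum.cl_ivl_Suc image_Suc_atLeastAtMost)
  have "(\<lambda>n. P n * X n - (\<Sum>k\<le>M. (\<Sum>l\<le>k. A_coeff (Suc q) ?a ?b l * 1 * \<gamma> l (k - l))
      / pochhammer (1 * of_nat n + \<sigma>) k)) \<in> O(\<lambda>n. 1 / of_nat n ^ (M + 1))"
  proof (rule inverse_factorial_expansion_mult)
    show "(\<lambda>n. X n - (\<Sum>l\<le>M. A_coeff (Suc q) ?a ?b l / pochhammer (of_nat n + \<sigma>') l))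
        \<in> O(\<lambda>n. 1 / of_nat n ^ (M + 1))"
      using Suc.IH[of ?a ?b] unfolding X_def \<sigma>'_def .
    show "P \<longlonglongrightarrow> 1"
      unfolding P_def by (rule balanced_Gamma_quotient_tendsto_1) (simp add: \<sigma>)
  next
    fix l assume "l \<le> M"
    show "eventually (\<lambda>n. P n / pochhammer (of_nat n + \<sigma>') l
        = 1 / pochhammer (1 * of_nat n + \<sigma>) l * Q l n) sequentially"
      using eventually_Gamma_shift[of \<sigma> l] eventually_Gamma_shift[of \<sigma>' l]
        pochhammer_eventually_nonzero[OF one_neq_zero, of \<sigma> l]
      by eventually_elim (simp add: P_def Q_def)
    show "(\<lambda>n. Q l n - (\<Sum>j\<le>M - l. \<gamma> l j / pochhammer (1 * of_nat n + \<sigma> + of_nat l) j))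
        \<in> O(\<lambda>n. 1 / of_nat n ^ (M - l + 1))"
      \<comment> \<open>For these \<open>c\<close>, \<open>A\<close>, \<open>B\<close> one has
        \<open>c - A - B = a 3\<close>, \<open>c - A = b 1\<close> and
        \<open>c - B = \<sigma>' + l\<close>.\<close>
      using gauss_expansion_at_top[of "\<sigma> + of_nat l" "\<sigma>' + of_nat l - a 3" "b 1 - a 3" "M - l"]
      by (simp add: Q_def \<gamma>_def gauss_sum_def \<sigma> algebra_simps)
  qed simp
  \<comment> \<open>The convolution is the recursion for \<open>A_coeff\<close>, because \<sigma>' -
    a 3 is the difference of parameter sums occurring there.\<close>
  moreover have "(\<Sum>l\<le>k. A_coeff (Suc q) ?a ?b l * 1 * \<gamma> l (k - l)) = A_coeff (Suc (Suc q)) a b k" for k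
  proof -
    have "(\<Sum>i=1..Suc (Suc q). b i) = b 1 + (\<Sum>i=2..q + 2. b i)"
      unfolding split_head(1) by simp
    then have "(\<Sum>i=2..q + 2. b i) - (\<Sum>i=3..q + 3. a i) = \<sigma> - b 1"
      unfolding \<sigma>_def by (simp only:) (simp add: eval_nat_numeral)
    then have "(\<Sum>i=2..q + 2. b i) - (\<Sum>i=3..q + 3. a i) = \<sigma>' - a 3"
      by (simp only: \<sigma>) simp
    then show ?thesis
      unfolding A_coeff.simps(3) \<gamma>_def atLeast0AtMost
      by (intro sum.cong) (simp_all only: mult_1_left mult_1_right add_diff_eq diff_add_eq mult_ac times_divide_eq_right times_divide_eq_left)
  qed
  ultimately have expansion: "(\<lambda>n. P n * X n - (\<Sum>k\<le>M. A_coeff (Suc (Suc q)) a b k / pochhammer (of_nat n + \<sigma>) k))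
      \<in> O(\<lambda>n. 1 / of_nat n ^ (M + 1))"
    by simp
  have "eventually (\<lambda>n. P n * X n = (\<Prod>i=3..Suc q + 2. Gamma (a i + of_nat n))
      / (\<Prod>i=1..Suc (Suc q). Gamma (b i + of_nat n)) * Gamma (\<sigma> + of_nat n)) sequentially"
    using eventually_Gamma_nonzero[of \<sigma>']
  proof eventually_elim
    case (elim n)
    then show ?case
      using head_notin unfolding split_head shift_sets P_def X_def
      by (simp add: prod.reindex del: prod.cl_ivl_Suc image_Suc_atLeastAtMost)
  qed
  then have "eventually (\<lambda>n. P n * X n - (\<Sum>k\<le>M. A_coeff (Suc (Suc q)) a b k / pochhammer (of_nat n + \<sigma>) k)
      = (\<Prod>i=3..Suc q + 2. Gamma (a i + of_nat n))
        / (\<Prod>i=1..Suc (Suc q). Gamma (b i + of_nat n)) * Gamma (\<sigma> + of_nat n)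
        - (\<Sum>k\<le>M. A_coeff (Suc (Suc q)) a b k / pochhammer (of_nat n + \<sigma>) k)) sequentially"
    by eventually_elim (simp only:)
  from landau_o.big.in_cong[OF this, THEN iffD1, OF expansion] show ?case
    unfolding \<sigma>_def[symmetric] .
qed


section \<open>Assembling the full expansion\<close>

lemma A_coeff_0: "p \<ge> 1 \<Longrightarrow> A_coeff p a b 0 = 1"
  by (induction p a b "0::nat" rule: A_coeff.induct) auto

theorem theorem1:
  fixes p M :: nat and a b :: "nat \<Rightarrow> complex"
  assumes "p \<ge> 1" and "M \<ge> 1"
  shows "(\<lambda>n::nat.
            (\<Prod>i=1..p + 1. Gamma (a i + of_nat n))
              / ((\<Prod>i=1..p. Gamma (b i + of_nat n)) * Gamma (- s_param p a b + of_nat n))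
            - (1 + (\<Sum>m=1..M. expansion_term p a b n m)))
         \<in> O[sequentially](\<lambda>n. 1 / of_nat n ^ (M + 1))"
proof -
  obtain q where p: "p = Suc q" using assms by (cases p) auto
  define s where "s = s_param p a b"
  define \<sigma> where "\<sigma> = (\<Sum>i=1..Suc q. b i) - (\<Sum>i=3..q + 2. a i)"
  define X where "X = (\<lambda>n. (\<Prod>i=3..q + 2. Gamma (a i + of_nat n))
      / (\<Prod>i=1..Suc q. Gamma (b i + of_nat n)) * Gamma (\<sigma> + of_nat n))"
  define P where "P = (\<lambda>n. Gamma (a 1 + of_nat n) * Gamma (a 2 + of_nat n)
      / (Gamma (- s + of_nat n) * Gamma (\<sigma> + of_nat n)))"
  \<comment> \<open>Unlike in the induction, both shifted parameters are in the denominator, so they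
    move in opposite directions and the quotient stays balanced.\<close>
  define Q where "Q = (\<lambda>l n. Gamma (a 1 + of_nat n) * Gamma (a 2 + of_nat n)
      / (Gamma (- s - of_nat l + of_nat n) * Gamma (\<sigma> + of_nat l + of_nat n)))"
  define \<gamma> where "\<gamma> = (\<lambda>l j. pochhammer (a 1 + s + of_nat l) j * pochhammer (a 2 + s + of_nat l) j / fact j)"
  have split_head: "{1..p + 1} = insert 1 (insert 2 {3..q + 2})"
    unfolding p by auto
  have s: "\<sigma> = a 1 + a 2 + s"
    unfolding s_def s_param_def \<sigma>_def split_head unfolding p by simp
  have "(\<lambda>n. P n * X n - (\<Sum>k\<le>M. (\<Sum>l\<le>k. A_coeff p a b l * (- 1) ^ l * \<gamma> l (k - l))
      / pochhammer (- 1 * of_nat n + (1 + s)) k)) \<in> O(\<lambda>n. 1 / of_nat n ^ (M + 1))"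
  proof (rule inverse_factorial_expansion_mult)
    show "(\<lambda>n. X n - (\<Sum>l\<le>M. A_coeff p a b l / pochhammer (of_nat n + \<sigma>) l))
        \<in> O(\<lambda>n. 1 / of_nat n ^ (M + 1))"
      using Gamma_quotient_expansion[where q = q and a = a and b = b] unfolding X_def \<sigma>_def p .
    show "P \<longlonglongrightarrow> 1"
      unfolding P_def by (rule balanced_Gamma_quotient_tendsto_1) (simp add: s)
  next
    fix l assume "l \<le> M"
    show "eventually (\<lambda>n. P n / pochhammer (of_nat n + \<sigma>) l
        = (- 1) ^ l / pochhammer (- 1 * of_nat n + (1 + s)) l * Q l n) sequentially"
      using eventually_Gamma_shift[of \<sigma> l] eventually_Gamma_shift[of "- s - of_nat l" l]
        pochhammer_eventually_nonzero[OF one_neq_zero, of "- s - of_nat l" l]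
    proof eventually_elim
      case (elim n)
      \<comment> \<open>Reversing the order of the factors turns \<open>(1 + s - n)_l\<close> into
        \<open>(n - s - l)_l\<close>, with the sign \<open>(-1)^l\<close>.\<close>
      have "pochhammer (- 1 * of_nat n + (1 + s)) l
          = (- 1) ^ l * pochhammer (of_nat n + (- s - of_nat l)) l"
        using pochhammer_minus[of "of_nat n - s - 1" l] by (simp add: algebra_simps)
      with elim show ?case by (simp add: P_def Q_def)
    qed
    show "(\<lambda>n. Q l n - (\<Sum>j\<le>M - l. \<gamma> l j / pochhammer (- 1 * of_nat n + (1 + s) + of_nat l) j))
        \<in> O(\<lambda>n. 1 / of_nat n ^ (M - l + 1))"
      \<comment> \<open>Here \<open>d + A = a 1\<close>, \<open>d + B = a 2\<close>,
        \<open>d + A + B = \<sigma> + l\<close> and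
        \<open>1 - d - n = 1 + s + l - n\<close>.\<close>
      using gauss_expansion_at_bot[of "- s - of_nat l" "a 1 + s + of_nat l" "a 2 + s + of_nat l" "M - l"]
      by (simp add: Q_def \<gamma>_def gauss_sum_def s algebra_simps)
  qed simp
  moreover have "(\<Sum>k\<le>M. (\<Sum>l\<le>k. A_coeff p a b l * (- 1) ^ l * \<gamma> l (k - l))
      / pochhammer (- 1 * of_nat n + (1 + s)) k) = 1 + (\<Sum>m=1..M. expansion_term p a b n m)" for n
  proof -
    have "(\<Sum>l\<le>k. A_coeff p a b l * (- 1) ^ l * \<gamma> l (k - l)) / pochhammer (- 1 * of_nat n + (1 + s)) k
        = expansion_term p a b n k" for k
    proof -
      have "A_coeff p a b l * (- 1) ^ l * \<gamma> l (k - l)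
          = 1 / fact k * (pochhammer (- of_nat k) l * pochhammer (a 1 + s + of_nat l) (k - l)
            * pochhammer (a 2 + s + of_nat l) (k - l) * A_coeff p a b l)" if "l \<le> k" for l
      proof -
        \<comment> \<open>This absorbs the sign \<open>(-1)^l\<close> and the
          \<open>1 / fact (k - l)\<close> of \<gamma>, leaving \<open>1 / fact k\<close>.\<close>
        have "pochhammer (- of_nat k :: complex) l = (- 1) ^ l * (fact k / fact (k - l))"
        proof -
          have "fact k = fact (k - l) * pochhammer (of_nat k - of_nat l + 1 :: complex) l"
            using that pochhammer_product'[of "1 :: complex" "k - l" l]
            by (simp add: pochhammer_fact of_nat_diff add.commute)
          then show ?thesis by (simp add: pochhammer_minus)
        qed
        then show ?thesis by (simp add: \<gamma>_def)
      qed
      then have "(\<Sum>l\<le>k. A_coeff p a b l * (- 1) ^ l * \<gamma> l (k - l))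
          = 1 / fact k * (\<Sum>l\<le>k. pochhammer (- of_nat k) l * pochhammer (a 1 + s + of_nat l) (k - l)
            * pochhammer (a 2 + s + of_nat l) (k - l) * A_coeff p a b l)"
        unfolding sum_distrib_left by (intro sum.cong) auto
      then show ?thesis
        unfolding expansion_term_def s_def[symmetric] atLeast0AtMost
        by (simp add: pochhammer_fact[symmetric] algebra_simps)
    qed
    then have "(\<Sum>k\<le>M. (\<Sum>l\<le>k. A_coeff p a b l * (- 1) ^ l * \<gamma> l (k - l))
      / pochhammer (- 1 * of_nat n + (1 + s)) k) = (\<Sum>m\<in>insert 0 {1..M}. expansion_term p a b n m)"
      by (intro sum.cong) auto
    \<comment> \<open>The term for \<open>m = 0\<close> is \<open>A_coeff p a b 0\<close>, which is
      1.\<close>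
    also have "\<dots> = 1 + (\<Sum>m=1..M. expansion_term p a b n m)"
      using A_coeff_0[OF assms(1), of a b] by (simp add: expansion_term_def)
    finally show ?thesis .
  qed
  ultimately have expansion: "(\<lambda>n. P n * X n - (1 + (\<Sum>m=1..M. expansion_term p a b n m)))
      \<in> O(\<lambda>n. 1 / of_nat n ^ (M + 1))"
    by (simp only:)
  have "eventually (\<lambda>n. P n * X n = (\<Prod>i=1..p + 1. Gamma (a i + of_nat n))
      / ((\<Prod>i=1..p. Gamma (b i + of_nat n)) * Gamma (- s_param p a b + of_nat n))) sequentially"
    using eventually_Gamma_nonzero[of \<sigma>]
  proof eventually_elim
    case (elim n)
    then show ?case
      unfolding split_head P_def X_def s_def[symmetric] unfolding p by simp
  qed
  then have "eventually (\<lambda>n. P n * X n - (1 + (\<Sum>m=1..M. expansion_term p a b n m))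
      = (\<Prod>i=1..p + 1. Gamma (a i + of_nat n))
        / ((\<Prod>i=1..p. Gamma (b i + of_nat n)) * Gamma (- s_param p a b + of_nat n))
        - (1 + (\<Sum>m=1..M. expansion_term p a b n m))) sequentially"
    by eventually_elim (simp only:)
  from landau_o.big.in_cong[OF this, THEN iffD1, OF expansion] show ?thesis .
qed

end
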